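(* Let $L$ be a finite-dimensional Lie algebra over a field $F$. (1) If $L$ is solvable, then $L$ is an $S$-Lie algebra; in fact $\mathrm{sol}_L(x)=L$ for every $x\in L$. (2) Conversely, assume that $F$ is algebraically closed of characteristic zero. If $L$ is an $S$-Lie algebra, then $L$ is solvable. In particular, if $F$ is algebraically closed of characteristic zero, then $L$ is solvable if and only if $L$ is an $S$-Lie algebra.
   Context: For elements $x,y$ of a Lie algebra $L$, $\langle x,y\rangle$ denotes the Lie subalgebra generated by $x$ and $y$. For $x\in L$, the solvabilizer of $x$ in $L$ is $\mathrm{sol}_L(x)=\{y\in L\mid \langle x,y\rangle \text{ is solvable}\}$. A finite-dimensional Lie algebra $L$ is called an $S$-Lie algebra if $\mathrm{sol}_L(x)$ is a Lie subalgebra of $L$ for every $x\in L$. *)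

theory Defs
  imports "HOL-Computational_Algebra.Computational_Algebra"
begin

text \<open>
  A Lie algebra is the whole type \<open>'v\<close>, with scalars in the field \<open>'f\<close>;
  subalgebras are sets of type \<open>'v set\<close>.
\<close>

locale lie_algebra = vector_space scale
  for scale :: "'f::field \<Rightarrow> 'v::ab_group_add \<Rightarrow> 'v" (infixr \<open>*s\<close> 75) +
  fixes bracket :: "'v \<Rightarrow> 'v \<Rightarrow> 'v"
  assumes bracket_add_left: "bracket (x + y) z = bracket x z + bracket y z"
    and bracket_add_right: "bracket x (y + z) = bracket x y + bracket x z"
    and bracket_scale_left: "bracket (a *s x) y = a *s bracket x y"
    and bracket_scale_right: "bracket x (a *s y) = a *s bracket x y"
    and bracket_self: "bracket x x = 0"
    and jacobi: "bracket x (bracket y z) + bracket y (bracket z x) + bracket z (bracket x y) = 0"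
begin

definition lie_subalgebra :: "'v set \<Rightarrow> bool" where
  "lie_subalgebra S \<longleftrightarrow> subspace S \<and> (\<forall>x\<in>S. \<forall>y\<in>S. bracket x y \<in> S)"

definition generated :: "'v \<Rightarrow> 'v \<Rightarrow> 'v set" where
  "generated x y = lie_subalgebra hull {x, y}"

primrec derived_series :: "'v set \<Rightarrow> nat \<Rightarrow> 'v set" where
  "derived_series S 0 = S"
| "derived_series S (Suc n) =
     span {bracket x y | x y. x \<in> derived_series S n \<and> y \<in> derived_series S n}"

text \<open>Meant for subalgebras \<open>S\<close>; the ambient algebra itself is \<open>S = UNIV\<close>.\<close>

definition solvable :: "'v set \<Rightarrow> bool" where
  "solvable S \<longleftrightarrow> (\<exists>n. derived_series S n = {0})"

definition solvabilizer :: "'v \<Rightarrow> 'v set" where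
  "solvabilizer x = {y. solvable (generated x y)}"

end

locale finite_dim_lie_algebra = lie_algebra +
  assumes finite_dim: "\<exists>B. finite B \<and> span B = UNIV"
begin

definition S_lie_algebra :: bool where
  "S_lie_algebra \<longleftrightarrow> (\<forall>x. lie_subalgebra (solvabilizer x))"

end

text \<open>
  A predicate on the scalar type rather than the class \<open>alg_closed_field\<close>, so that it can be
  a hypothesis on one part of a statement about an arbitrary field.
\<close>

definition algebraically_closed :: "'f::field itself \<Rightarrow> bool" where
  "algebraically_closed _ \<longleftrightarrow> (\<forall>p :: 'f poly. degree p > 0 \<longrightarrow> (\<exists>z. poly p z = 0))"

end

theory Submission
  imports Defs
begin

text \<open>
  Let \<open>M\<close> be a nonsolvable subalgebra of least dimension. It is perfect, and its proper subalgebras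
  are solvable. By Lie's theorem on \<open>M / K\<close>, a maximal subalgebra \<open>K\<close> of \<open>M\<close> has codimension one and
  acts on \<open>M / K\<close> by a character \<open>\<chi>\<close>. Since \<open>M\<close> is perfect, every \<open>x \<in> M - K\<close> has some \<open>y \<in> ker \<chi>\<close>
  with \<open>\<chi> [x, y] \<noteq> 0\<close>, a shadow of an \<open>sl\<^sub>2\<close>-triple.

  Let \<open>K'\<close> be a maximal subalgebra containing \<open>x\<close>. Some \<open>h \<in> K \<inter> K'\<close> has \<open>\<chi> h = 1\<close>, and as \<open>K\<close> and \<open>K'\<close>
  are solvable, the solvabilizer of \<open>h\<close> contains \<open>K\<close> and \<open>x\<close>. If it is a subspace, it contains \<open>M\<close>.
  But a suitable \<open>w \<in> x + K\<close> has \<open>u = [h, w] - w \<in> ker \<chi>\<close> with \<open>\<chi> [w, u] \<noteq> 0\<close>, and a subalgebra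
  containing such a pair cannot be solvable.
\<close>

section \<open>Bracket identities, subalgebras and the derived series\<close>

context lie_algebra
begin

lemma bracket_zero_left [simp]: "bracket 0 x = 0"
  using bracket_scale_left[of 0 0 x] by simp

lemma bracket_zero_right [simp]: "bracket x 0 = 0"
  using bracket_scale_right[of x 0 0] by simp

lemma bracket_minus_left: "bracket (- x) y = - bracket x y"
  using bracket_scale_left[of "-1" x y] by simp

lemma bracket_minus_right: "bracket x (- y) = - bracket x y"
  using bracket_scale_right[of x "-1" y] by simp

lemma bracket_diff_left: "bracket (x - y) z = bracket x z - bracket y z"
  using bracket_add_left[of x "-y" z] by (simp add: bracket_minus_left)

lemma bracket_diff_right: "bracket x (y - z) = bracket x y - bracket x z"
  using bracket_add_right[of x y "-z"] by (simp add: bracket_minus_right)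

lemmas bracket_linear = bracket_add_left bracket_add_right bracket_diff_left bracket_diff_right
  bracket_minus_left bracket_minus_right bracket_scale_left bracket_scale_right

lemma bracket_anticommute: "bracket x y = - bracket y x"
proof -
  have "0 = bracket (x + y) (x + y)"
    by (rule bracket_self[symmetric])
  also have "\<dots> = bracket x y + bracket y x"
    by (simp only: bracket_add_left bracket_add_right) (simp add: bracket_self add.commute)
  finally have "bracket x y + bracket y x = 0" ..
  then show ?thesis
    by (simp add: eq_neg_iff_add_eq_0)
qed

lemma bracket_derivation: "bracket x (bracket y z) = bracket (bracket x y) z + bracket y (bracket x z)"
proof -
  have "bracket y (bracket z x) = - bracket y (bracket x z)"
    by (subst bracket_anticommute[of z x]) (rule bracket_minus_right)
  moreover have "bracket z (bracket x y) = - bracket (bracket x y) z"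
    by (rule bracket_anticommute)
  ultimately show ?thesis
    using jacobi[of x y z] by (simp add: algebra_simps)
qed

lemma linear_bracket: "Vector_Spaces.linear scale scale (bracket x)"
  by unfold_locales (simp_all add: bracket_linear)

lemma lie_subalgebra_subspace: "lie_subalgebra S \<Longrightarrow> subspace S"
  by (simp add: lie_subalgebra_def)

lemma lie_subalgebra_bracket: "lie_subalgebra S \<Longrightarrow> x \<in> S \<Longrightarrow> y \<in> S \<Longrightarrow> bracket x y \<in> S"
  by (simp add: lie_subalgebra_def)

lemma lie_subalgebra_UNIV [simp]: "lie_subalgebra UNIV"
  by (simp add: lie_subalgebra_def)

lemma lie_subalgebra_generated: "lie_subalgebra (generated x y)"
  unfolding generated_def
  by (rule hull_in) (auto simp: lie_subalgebra_def subspace_def)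

lemma generated_left: "x \<in> generated x y"
  unfolding generated_def by (rule hull_inc) simp

lemma generated_right: "y \<in> generated x y"
  unfolding generated_def by (rule hull_inc) simp

lemma generated_subset: "lie_subalgebra S \<Longrightarrow> x \<in> S \<Longrightarrow> y \<in> S \<Longrightarrow> generated x y \<subseteq> S"
  unfolding generated_def by (rule hull_minimal) auto

abbreviation derived :: "'v set \<Rightarrow> 'v set" where
  "derived S \<equiv> span {bracket x y | x y. x \<in> S \<and> y \<in> S}"

lemma derived_mono: "S \<subseteq> T \<Longrightarrow> derived S \<subseteq> derived T"
  by (rule span_mono) auto

lemma bracket_in_derived: "x \<in> S \<Longrightarrow> y \<in> S \<Longrightarrow> bracket x y \<in> derived S"
  by (rule span_base) auto

lemma derived_subset: "lie_subalgebra S \<Longrightarrow> derived S \<subseteq> S"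
  by (rule span_minimal) (auto simp: lie_subalgebra_def)

text \<open>Brackets of elements of \<open>T\<close> already land in \<open>derived S\<close>. This
  makes every hyperplane above \<open>derived S\<close> a subalgebra, as the induction for Lie's
  theorem requires.\<close>

lemma lie_subalgebra_between:
  assumes "lie_subalgebra S" "subspace T" "derived S \<subseteq> T" "T \<subseteq> S"
  shows "lie_subalgebra T"
  unfolding lie_subalgebra_def
proof (intro conjI ballI)
  fix x y assume "x \<in> T" "y \<in> T"
  then have "bracket x y \<in> derived S"
    using assms(4) by (intro bracket_in_derived) auto
  then show "bracket x y \<in> T"
    using assms(3) by blast
qed (rule assms(2))

lemma lie_subalgebra_derived: "lie_subalgebra S \<Longrightarrow> lie_subalgebra (derived S)"
  using lie_subalgebra_between[of S "derived S"] derived_subset subspace_span by blast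

lemma lie_subalgebra_derived_series: "lie_subalgebra S \<Longrightarrow> lie_subalgebra (derived_series S n)"
  by (induction n) (simp_all only: derived_series.simps lie_subalgebra_derived)

lemma derived_series_mono: "S \<subseteq> T \<Longrightarrow> derived_series S n \<subseteq> derived_series T n"
  by (induction n) (simp_all add: derived_mono)

text \<open>The recursion applies \<open>derived\<close> on the outside; moving it inside lets
  solvability be lifted from \<open>derived S\<close> to \<open>S\<close>.\<close>

lemma derived_series_Suc_shift: "derived_series S (Suc n) = derived_series (derived S) n"
proof (induction n)
  case (Suc n)
  show ?case
    using arg_cong[OF Suc, of derived] by simp
qed simp

lemma solvable_subset:
  assumes "solvable T" "lie_subalgebra S" "S \<subseteq> T"
  shows "solvable S"
proof -
  obtain n where "derived_series T n = {0}"
    using assms(1) by (auto simp: solvable_def)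
  then have "derived_series S n \<subseteq> {0}"
    using derived_series_mono[OF assms(3)] by blast
  then have "derived_series S n = {0}"
    using subspace_0[OF lie_subalgebra_subspace[OF lie_subalgebra_derived_series[OF assms(2)]], of n]
    by blast
  then show ?thesis
    by (auto simp: solvable_def)
qed

lemma solvable_if_derived: "solvable (derived S) \<Longrightarrow> solvable S"
  unfolding solvable_def by (metis derived_series_Suc_shift)

lemma perfect_solvable_trivial:
  assumes "solvable S" "derived S = S"
  shows "S = {0}"
proof -
  have "derived_series S n = S" for n
    by (induction n) (use assms(2) in simp_all)
  then show ?thesis
    using assms(1) by (auto simp: solvable_def)
qed

lemma lie_subalgebra_span_singleton: "lie_subalgebra (span {x})"
  unfolding lie_subalgebra_def
  by (intro conjI subspace_span) (auto simp: span_singleton bracket_linear bracket_self)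

lemma solvable_span_singleton: "solvable (span {x})"
proof -
  have *: "bracket y z = 0" if yz: "y \<in> span {x}" "z \<in> span {x}" for y z
  proof -
    obtain a b where "y = a *s x" "z = b *s x"
      using yz by (auto simp: span_singleton)
    then show ?thesis
      by (simp add: bracket_scale_left bracket_scale_right bracket_self)
  qed
  have "derived (span {x}) \<subseteq> {0}"
    by (rule span_minimal) (auto simp: * subspace_single_0)
  then have "derived_series (span {x}) 1 = {0}"
    using subspace_0[OF subspace_span, of "{bracket y z | y z. y \<in> span {x} \<and> z \<in> span {x}}"] by auto
  then show ?thesis
    unfolding solvable_def by blast
qed

text \<open>Solvability passes to subalgebras, so a common solvable subalgebra of any size is
  enough.\<close>

lemma in_solvabilizer:
  "solvable S \<Longrightarrow> lie_subalgebra S \<Longrightarrow> x \<in> S \<Longrightarrow> y \<in> S \<Longrightarrow> y \<in> solvabilizer x"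
  unfolding solvabilizer_def
  using solvable_subset lie_subalgebra_generated generated_subset by blast

lemma solvabilizer_eq_UNIV: "solvable UNIV \<Longrightarrow> solvabilizer x = UNIV"
  using in_solvabilizer[of UNIV] by auto

end

section \<open>Polynomials acting through an endomorphism\<close>

locale linear_endomorphism = vector_space scale + T: Vector_Spaces.linear scale scale T
  for scale :: "'a::field \<Rightarrow> 'b::ab_group_add \<Rightarrow> 'b" and T :: "'b \<Rightarrow> 'b"
begin

text \<open>This is \<open>p(T) v\<close>, evaluated by Horner's scheme.\<close>

definition poly_act :: "'a poly \<Rightarrow> 'b \<Rightarrow> 'b" where
  "poly_act p v = fold_coeffs (\<lambda>a w. scale a v + T w) p 0"

lemma poly_act_0 [simp]: "poly_act 0 v = 0"
  by (simp add: poly_act_def)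

lemma poly_act_pCons [simp]: "poly_act (pCons a p) v = scale a v + T (poly_act p v)"
  unfolding poly_act_def by (cases "p = 0 \<and> a = 0") (auto simp: T.zero fold_coeffs_pCons_coeff_not_0_eq fold_coeffs_pCons_not_0_0_eq)

lemma poly_act_add: "poly_act (p + q) v = poly_act p v + poly_act q v"
  by (induction p q rule: poly_induct2) (simp_all add: T.add scale_left_distrib)

lemma poly_act_smult: "poly_act (smult c p) v = scale c (poly_act p v)"
  by (induction p) (simp_all add: T.scale scale_right_distrib)

lemma poly_act_diff: "poly_act (p - q) v = poly_act p v - poly_act q v"
  using poly_act_add[of p "smult (-1) q" v] poly_act_smult[of "-1" q v] by simp

lemma poly_act_monom: "poly_act (monom 1 n) v = (T ^^ n) v"
  by (induction n) (simp_all add: monom_0 monom_Suc T.zero)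

lemma poly_act_linear_factor:
  "poly_act ([:- c, 1:] * q) v = T (poly_act q v) - scale c (poly_act q v)"
proof -
  have "[:- c, 1:] * q = pCons 0 q - smult c q"
    by (simp add: algebra_simps)
  then show ?thesis
    by (simp only: poly_act_diff poly_act_smult poly_act_pCons scale_zero_left add_0_left)
qed

lemma poly_act_in_subspace:
  "subspace W \<Longrightarrow> (\<And>w. w \<in> W \<Longrightarrow> T w \<in> W) \<Longrightarrow> v \<in> W \<Longrightarrow> poly_act p v \<in> W"
  by (induction p) (simp_all add: subspace_0 subspace_add subspace_scale)

text \<open>Split off a root: \<open>p = (X - \<mu>) q\<close>. Either \<open>q(T) w\<close> is
  still in \<open>U\<close> and \<open>q\<close> replaces \<open>p\<close>, or \<open>q(T) w\<close>
  is the desired vector with eigenvalue \<open>\<mu>\<close>. The descent cannot end at a constant,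
  since that would put \<open>w\<close> into \<open>U\<close>.\<close>

lemma eigenvector_modulo_of_annihilator:
  assumes ac: "algebraically_closed TYPE('a)"
    and W: "subspace W" "\<And>w. w \<in> W \<Longrightarrow> T w \<in> W" and U: "subspace U"
    and w: "w \<in> W" "w \<notin> U" and p: "p \<noteq> 0" "poly_act p w \<in> U"
  shows "\<exists>v \<mu>. v \<in> W \<and> v \<notin> U \<and> T v - scale \<mu> v \<in> U"
  using p
proof (induction "degree p" arbitrary: p rule: less_induct)
  case less
  show ?case
  proof (cases "degree p = 0")
    case True
    then obtain a where p: "p = [:a:]"
      by (metis degree_0_id)
    then have "a \<noteq> 0" "scale a w \<in> U"
      using less.prems by (auto simp: T.zero)
    then have "w \<in> U"
      using subspace_scale[OF U, of "scale a w" "inverse a"] by simp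
    then show ?thesis
      using w by simp
  next
    case False
    then obtain \<mu> where "poly p \<mu> = 0"
      using ac by (auto simp: algebraically_closed_def)
    then obtain q where q: "p = [:- \<mu>, 1:] * q"
      by (metis dvdE poly_eq_0_iff_dvd)
    then have "q \<noteq> 0"
      using less.prems by auto
    then have deg: "degree q < degree p"
      unfolding q by (subst degree_mult_eq) auto
    show ?thesis
    proof (cases "poly_act q w \<in> U")
      case True
      then show ?thesis
        using less.hyps[OF deg \<open>q \<noteq> 0\<close>] by simp
    next
      case False
      moreover have "poly_act q w \<in> W"
        using poly_act_in_subspace W w by blast
      moreover have "T (poly_act q w) - scale \<mu> (poly_act q w) \<in> U"
        using less.prems(2) unfolding q poly_act_linear_factor .
      ultimately show ?thesis
        by blast
    qed
  qed
qed

text \<open>Elements of the Krylov space are, modulo \<open>U\<close>, values \<open>q(T) w\<close>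
  with \<open>q\<close> of degree below \<open>n\<close>. Bounding coefficients instead of the
  degree also covers \<open>n = 0\<close>, where \<open>q\<close> must vanish.\<close>

lemma krylov_span_poly_act:
  assumes U: "subspace U" and x: "x \<in> span (U \<union> (\<lambda>i. (T ^^ i) w) ` {..<n})"
  shows "\<exists>q. (\<forall>i\<ge>n. coeff q i = 0) \<and> x - poly_act q w \<in> U"
proof -
  let ?P = "{x. \<exists>q. (\<forall>i\<ge>n. coeff q i = 0) \<and> x - poly_act q w \<in> U}"
  have "U \<union> (\<lambda>i. (T ^^ i) w) ` {..<n} \<subseteq> ?P"
  proof
    fix x assume "x \<in> U \<union> (\<lambda>i. (T ^^ i) w) ` {..<n}"
    then consider "x \<in> U" | i where "i < n" "x = (T ^^ i) w"
      by auto
    then show "x \<in> ?P"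
    proof cases
      case 1
      then show ?thesis
        by (auto intro!: exI[of _ 0])
    next
      case 2
      then show ?thesis
        using U by (auto intro!: exI[of _ "monom 1 i"] simp: poly_act_monom subspace_0)
    qed
  qed
  moreover have "subspace ?P"
  proof (rule subspaceI)
    show "0 \<in> ?P"
      using U by (auto intro!: exI[of _ 0] simp: subspace_0)
  next
    fix x y assume "x \<in> ?P" "y \<in> ?P"
    then obtain p q where "\<forall>i\<ge>n. coeff p i = 0" "x - poly_act p w \<in> U"
      "\<forall>i\<ge>n. coeff q i = 0" "y - poly_act q w \<in> U"
      by blast
    then show "x + y \<in> ?P"
      using subspace_add[OF U, of "x - poly_act p w" "y - poly_act q w"]
      by (auto intro!: exI[of _ "p + q"] simp: poly_act_add algebra_simps)
  next
    fix c x assume "x \<in> ?P"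
    then obtain p where "\<forall>i\<ge>n. coeff p i = 0" "x - poly_act p w \<in> U"
      by blast
    then show "scale c x \<in> ?P"
      using subspace_scale[OF U, of "x - poly_act p w" c]
      by (auto intro!: exI[of _ "smult c p"] simp: poly_act_smult scale_right_diff_distrib)
  qed
  ultimately show ?thesis
    using span_minimal x by blast
qed

end

context finite_dimensional_vector_space
begin

lemma dim_psubset_subspaces: "subspace S \<Longrightarrow> subspace T \<Longrightarrow> S \<subset> T \<Longrightarrow> dim S < dim T"
  by (rule dim_psubset) (simp only: span_eq_iff[THEN iffD2])

text \<open>Otherwise each iterate would enlarge the span, and its dimension would exceed that of
  the whole space.\<close>

lemma krylov_stabilizes:
  assumes "subspace U"
  shows "\<exists>n. (T ^^ n) w \<in> span (U \<union> (\<lambda>i. (T ^^ i) w) ` {..<n})"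
proof (rule ccontr)
  let ?S = "\<lambda>n. span (U \<union> (\<lambda>i. (T ^^ i) w) ` {..<n})"
  assume contra: "\<not> ?thesis"
  have "n \<le> dim (?S n)" for n
  proof (induction n)
    case (Suc n)
    have "(T ^^ n) w \<in> ?S (Suc n)"
      by (rule span_base) auto
    moreover have "?S n \<subseteq> ?S (Suc n)"
      by (rule span_mono) auto
    ultimately have "?S n \<subset> ?S (Suc n)"
      using contra by blast
    then have "dim (?S n) < dim (?S (Suc n))"
      by (intro dim_psubset) (simp add: span_span)
    then show ?case
      using Suc by simp
  qed simp
  from this[of "Suc dimension"] show False
    using dim_subset_UNIV[of "?S (Suc dimension)"] by simp
qed

lemma exists_eigenvector_modulo:
  assumes ac: "algebraically_closed TYPE('a)"
    and T: "Vector_Spaces.linear scale scale T"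
    and W: "subspace W" "\<And>w. w \<in> W \<Longrightarrow> T w \<in> W" and U: "subspace U"
    and w: "w \<in> W" "w \<notin> U"
  shows "\<exists>v \<mu>. v \<in> W \<and> v \<notin> U \<and> T v - scale \<mu> v \<in> U"
proof -
  interpret linear_endomorphism scale T
    using T vector_space_axioms by (simp add: linear_endomorphism_def)
  obtain n where "(T ^^ n) w \<in> span (U \<union> (\<lambda>i. (T ^^ i) w) ` {..<n})"
    using krylov_stabilizes[OF U, of T w] by (elim exE)
  then obtain q where q: "\<forall>i\<ge>n. coeff q i = 0" "(T ^^ n) w - poly_act q w \<in> U"
    using krylov_span_poly_act[OF U] by blast
  \<comment> \<open>The annihilator \<open>X^n - q\<close> is nonzero because \<open>q\<close> has
    no coefficients from \<open>n\<close> on.\<close>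
  have "coeff (monom 1 n - q) n = 1"
    using q(1) by simp
  then have "monom 1 n - q \<noteq> 0"
    by (metis coeff_0 zero_neq_one)
  moreover have "poly_act (monom 1 n - q) w \<in> U"
    using q(2) by (simp add: poly_act_diff poly_act_monom)
  ultimately show ?thesis
    using eigenvector_modulo_of_annihilator[OF ac W U w] by blast
qed

end

section \<open>Lie's theorem relative to an invariant subspace\<close>

locale based_lie_algebra = lie_algebra scale bracket + finite_dimensional_vector_space scale Basis
  for scale :: "'f::field \<Rightarrow> 'v::ab_group_add \<Rightarrow> 'v" (infixr \<open>*s\<close> 75) and bracket Basis
begin

text \<open>
  The usual trace argument is replaced by following one coefficient. For \<open>w\<^sub>i = (ad z)\<^sup>i w\<close>, the
  operator \<open>ad a - \<chi> a\<close> sends \<open>w\<close> of index \<open>i + 1\<close> to \<open>(i + 1) * \<chi> [a, z] * w\<^sub>i\<close> modulo \<open>U\<close> and the span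
  of the earlier vectors. At the first dependent vector this coefficient must vanish.
\<close>

lemma weight_vanishes_on_commutators:
  assumes char0: "CHAR('f) = 0"
    and U: "subspace U" "\<And>u. u \<in> U \<Longrightarrow> bracket z u \<in> U" "\<And>a u. a \<in> A \<Longrightarrow> u \<in> U \<Longrightarrow> bracket a u \<in> U"
    and A: "\<And>a. a \<in> A \<Longrightarrow> bracket a z \<in> A"
    and w: "w \<notin> U" "\<And>a. a \<in> A \<Longrightarrow> bracket a w - \<chi> a *s w \<in> U"
    and a: "a \<in> A"
  shows "\<chi> (bracket a z) = 0"
proof -
  define ws where "ws i = (bracket z ^^ i) w" for i
  define S where "S i = span (U \<union> ws ` {..<i})" for i
  have ws_Suc: "ws (Suc i) = bracket z (ws i)" for i
    by (simp add: ws_def)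
  have S: "subspace (S i)" for i
    by (simp add: S_def)
  have S_mono: "i \<le> j \<Longrightarrow> S i \<subseteq> S j" for i j
    unfolding S_def by (intro span_mono Un_mono image_mono) auto
  have U_S: "U \<subseteq> S i" for i
    unfolding S_def using span_superset by blast
  have ws_S: "ws i \<in> S (Suc i)" for i
    unfolding S_def by (rule span_base) auto
  have S_0: "S 0 = U"
    by (simp add: S_def U(1)  span_eq_iff)
  have z_S: "bracket z x \<in> S (Suc i)" if "x \<in> S i" for x i
  proof -
    have "subspace {x. bracket z x \<in> S (Suc i)}"
      using S[of "Suc i"] by (auto intro!: subspaceI simp: bracket_linear subspace_0 subspace_add subspace_scale)
    moreover have "bracket z x \<in> S (Suc i)" if "x \<in> U \<union> ws ` {..<i}" for x
    proof -
      consider "x \<in> U" | j where "j < i" "x = ws j"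
        using \<open>x \<in> U \<union> ws ` {..<i}\<close> by auto
      then show ?thesis
      proof cases
        case 1
        then show ?thesis
          using U(2) U_S by blast
      next
        case 2
        then show ?thesis
          using ws_S[of "Suc j"] S_mono[of "Suc (Suc j)" "Suc i"] by (auto simp: ws_Suc)
      qed
    qed
    ultimately show ?thesis
      using \<open>x \<in> S i\<close> span_minimal[of "U \<union> ws ` {..<i}" "{x. bracket z x \<in> S (Suc i)}"]
      unfolding S_def by blast
  qed
  have weight_of_shift: "bracket b (ws (Suc i)) - \<chi> b *s ws (Suc i) \<in> S (Suc i)"
    if "bracket b (ws (Suc i)) - \<chi> b *s ws (Suc i) - (of_nat (Suc i) * \<chi> (bracket b z)) *s ws i \<in> S i"
    for b i
  proof -
    have "(of_nat (Suc i) * \<chi> (bracket b z)) *s ws i \<in> S (Suc i)"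
      using S ws_S subspace_scale by blast
    then show ?thesis
      using subspace_add[OF S] that S_mono[of i "Suc i"] by fastforce
  qed
  have shift: "bracket b (ws (Suc i)) - \<chi> b *s ws (Suc i) - (of_nat (Suc i) * \<chi> (bracket b z)) *s ws i \<in> S i"
    if "b \<in> A" for b i
    using that
  proof (induction i arbitrary: b)
    case 0
    have "bracket b (ws 1) - \<chi> b *s ws 1 - \<chi> (bracket b z) *s w =
        (bracket (bracket b z) w - \<chi> (bracket b z) *s w) + bracket z (bracket b w - \<chi> b *s w)"
      by (simp add: ws_def bracket_derivation[of b z w] bracket_linear algebra_simps)
    also have "\<dots> \<in> U"
      using w(2) A U 0 by (intro subspace_add) auto
    finally show ?case
      by (simp add: S_0 ws_def)
  next
    \<comment> \<open>With \<open>bracket b z\<close> taken out by the derivation rule, one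
      \<open>c\<close> is the weight of \<open>bracket b z\<close> on \<open>ws (Suc i)\<close>; the
      remaining \<open>d\<close> is the coefficient from the induction hypothesis, moved up one
      index by \<open>bracket z\<close>.\<close>
    case (Suc i)
    define c where "c = \<chi> (bracket b z)"
    define d where "d = of_nat (Suc i) * c"
    define r where "r = bracket b (ws (Suc i)) - \<chi> b *s ws (Suc i) - d *s ws i"
    have "of_nat (Suc (Suc i)) * c = c + d"
      by (simp add: d_def algebra_simps)
    then have split: "(of_nat (Suc (Suc i)) * c) *s x = c *s x + d *s x" for x
      by (simp only: scale_left_distrib)
    have "bracket b (ws (Suc (Suc i))) - \<chi> b *s ws (Suc (Suc i)) - (of_nat (Suc (Suc i)) * c) *s ws (Suc i) =
        (bracket (bracket b z) (ws (Suc i)) - c *s ws (Suc i)) + bracket z r"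
      unfolding split
      by (simp add: r_def ws_Suc bracket_derivation[of b z "bracket z (ws i)"] bracket_linear algebra_simps)
    also have "\<dots> \<in> S (Suc i)"
      using weight_of_shift[OF Suc.IH[OF A[OF Suc.prems]]] z_S Suc.IH[OF Suc.prems]
      unfolding r_def c_def d_def by (intro subspace_add S)
    finally show ?case
      by (simp only: c_def)
  qed
  have weight: "bracket b (ws i) - \<chi> b *s ws i \<in> S i" if "b \<in> A" for b i
  proof (cases i)
    case 0
    then show ?thesis
      using w(2)[OF that] by (simp add: S_0 ws_def)
  next
    case (Suc j)
    then show ?thesis
      using weight_of_shift[OF shift[OF that]] by simp
  qed
  \<comment> \<open>For this least \<open>n = Suc m\<close>, the operator
    \<open>ad a - \<chi> a\<close> maps \<open>S n\<close>, hence \<open>ws n\<close>, into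
    \<open>S m\<close>. Comparing with \<open>shift\<close> puts a multiple of \<open>ws m\<close>
    into \<open>S m\<close>, although \<open>ws m\<close> itself is not there.\<close>
  define n where "n = (LEAST n. ws n \<in> S n)"
  have "\<exists>n. ws n \<in> S n"
    using krylov_stabilizes[OF U(1), of "bracket z" w] by (simp add: ws_def S_def)
  then have n: "ws n \<in> S n" and below_n: "\<And>m. m < n \<Longrightarrow> ws m \<notin> S m"
    unfolding n_def by (auto intro: LeastI_ex dest: not_less_Least)
  have "n \<noteq> 0"
    using n w(1) S_0 by (metis funpow_0 ws_def)
  then obtain m where m: "n = Suc m"
    using not0_implies_Suc by blast
  have "subspace {x. bracket a x - \<chi> a *s x \<in> S m}"
  proof (rule subspaceI)
    fix x y assume "x \<in> {x. bracket a x - \<chi> a *s x \<in> S m}" "y \<in> {x. bracket a x - \<chi> a *s x \<in> S m}"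
    then show "x + y \<in> {x. bracket a x - \<chi> a *s x \<in> S m}"
      using subspace_add[OF S, of "bracket a x - \<chi> a *s x" m "bracket a y - \<chi> a *s y"]
      by (simp add: bracket_linear algebra_simps)
  next
    fix c x assume "x \<in> {x. bracket a x - \<chi> a *s x \<in> S m}"
    then show "c *s x \<in> {x. bracket a x - \<chi> a *s x \<in> S m}"
      using subspace_scale[OF S, of "bracket a x - \<chi> a *s x" m c]
      by (simp add: bracket_linear algebra_simps)
  qed (simp add: S subspace_0)
  moreover have "bracket a x - \<chi> a *s x \<in> S m" if x: "x \<in> U \<union> ws ` {..<Suc m}" for x
  proof -
    consider "x \<in> U" | j where "j \<le> m" "x = ws j"
      using x by (auto simp: less_Suc_eq_le)
    then show ?thesis
    proof cases
      case 1
      then have "bracket a x - \<chi> a *s x \<in> U"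
        using U a by (intro subspace_diff subspace_scale) auto
      then show ?thesis
        using U_S by blast
    next
      case 2
      then show ?thesis
        using weight[OF a, of j] S_mono[of j m] by auto
    qed
  qed
  ultimately have "bracket a (ws n) - \<chi> a *s ws n \<in> S m"
    using n span_minimal[of "U \<union> ws ` {..<Suc m}" "{x. bracket a x - \<chi> a *s x \<in> S m}"]
    unfolding S_def m by blast
  then have "(of_nat (Suc m) * \<chi> (bracket a z)) *s ws m \<in> S m"
    using subspace_diff[OF S _ shift[OF a, of m]] unfolding m by fastforce
  moreover define d where "d = of_nat (Suc m) * \<chi> (bracket a z)"
  ultimately have d: "d *s ws m \<in> S m"
    by (simp only:)
  have "d = 0"
  proof (rule ccontr)
    assume "d \<noteq> 0"
    then have "ws m \<in> S m"
      using subspace_scale[OF S d, of "inverse d"] by simp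
    then show False
      using below_n[of m] m by simp
  qed
  then have "of_nat (Suc m) * \<chi> (bracket a z) = 0"
    by (simp only: d_def)
  \<comment> \<open>Here characteristic zero enters.\<close>
  moreover have "(of_nat (Suc m) :: 'f) \<noteq> 0"
    using char0 by (simp only: of_nat_eq_0_iff_char_dvd) simp
  ultimately show ?thesis
    by simp
qed

text \<open>A proper subspace \<open>H\<close> of greatest dimension works: adjoining any
  \<open>z\<close> outside it must fill \<open>S\<close>.\<close>

lemma exists_hyperplane_above:
  assumes "subspace D" "subspace S" "D \<subset> S"
  obtains H z where "subspace H" "D \<subseteq> H" "H \<subset> S" "z \<in> S" "z \<notin> H" "\<And>s. s \<in> S \<Longrightarrow> \<exists>c. s - c *s z \<in> H"
proof -
  let ?P = "\<lambda>H. subspace H \<and> D \<subseteq> H \<and> H \<subset> S"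
  have "?P D"
    using assms by simp
  then have "\<exists>H. ?P H \<and> (\<forall>T. ?P T \<longrightarrow> dim T \<le> dim H)"
    by (rule ex_has_greatest_nat[of ?P _ dim "Suc dimension"]) (simp add: dim_subset_UNIV less_Suc_eq_le)
  then obtain H where H: "?P H" and max: "\<And>T. ?P T \<Longrightarrow> dim T \<le> dim H"
    by blast
  then obtain z where z: "z \<in> S" "z \<notin> H"
    by blast
  have "H \<subset> span (insert z H)"
    using z(2) span_superset[of "insert z H"] by blast
  then have "dim H < dim (span (insert z H))"
    using H by (intro dim_psubset_subspaces) auto
  moreover have "span (insert z H) \<subseteq> S"
    using z H assms(2) by (intro span_minimal) auto
  ultimately have "span (insert z H) = S"
    using max[of "span (insert z H)"] H \<open>H \<subset> span (insert z H)\<close> by force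
  then have "\<exists>c. s - c *s z \<in> H" if "s \<in> S" for s
    using that span_breakdown_eq[of s z H] span_eq_iff[of H] H by metis
  then show thesis
    using that H z by blast
qed

text \<open>Lie's theorem for the action of \<open>K\<close> on \<open>V / U\<close>, phrased with
  congruences modulo \<open>U\<close> so that no quotient space is built. By induction a hyperplane
  \<open>H\<close> above \<open>derived K\<close> has a common eigenvector; its weight space is
  stable under a complement \<open>z\<close>, and an eigenvector of \<open>z\<close> in it serves
  all of \<open>K\<close>.\<close>

theorem lie_theorem_modulo:
  assumes ac: "algebraically_closed TYPE('f)" and char0: "CHAR('f) = 0"
    and K: "lie_subalgebra K" "solvable K"
    and V: "subspace V" "\<And>k v. k \<in> K \<Longrightarrow> v \<in> V \<Longrightarrow> bracket k v \<in> V"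
    and U: "subspace U" "\<And>k u. k \<in> K \<Longrightarrow> u \<in> U \<Longrightarrow> bracket k u \<in> U"
    and UV: "U \<subset> V"
  shows "\<exists>v\<in>V. v \<notin> U \<and> (\<forall>k\<in>K. \<exists>c. bracket k v - c *s v \<in> U)"
  using K V(2) U(2)
proof (induction "dim K" arbitrary: K rule: less_induct)
  case less
  show ?case
  proof (cases "K = {0}")
    case True
    obtain v where "v \<in> V" "v \<notin> U"
      using UV by blast
    then show ?thesis
      using True subspace_0[OF U(1)] by (auto intro!: bexI[of _ v] exI[of _ 0])
  next
    case False
    then have "derived K \<noteq> K"
      using perfect_solvable_trivial[OF less.prems(2)] by metis
    then have "derived K \<subset> K"
      using derived_subset[OF less.prems(1)] by (simp only: psubset_eq simp_thms)
    obtain H z where H: "subspace H" "derived K \<subseteq> H" "H \<subset> K"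
      and z: "z \<in> K" "z \<notin> H" "\<And>k. k \<in> K \<Longrightarrow> \<exists>c. k - c *s z \<in> H"
      by (rule exists_hyperplane_above[OF subspace_span lie_subalgebra_subspace[OF less.prems(1)]
            \<open>derived K \<subset> K\<close>]) (rule that)
    have H_sub: "lie_subalgebra H"
      using lie_subalgebra_between[of K H] H less.prems(1) by simp
    have "dim H < dim K"
      using H(1,3) lie_subalgebra_subspace[OF less.prems(1)] by (intro dim_psubset_subspaces)
    then have "\<exists>v\<in>V. v \<notin> U \<and> (\<forall>k\<in>H. \<exists>c. bracket k v - c *s v \<in> U)"
      using H H_sub less.prems(2) solvable_subset[of K H]
      by (intro less.hyps less.prems(3,4)) auto
    then obtain v \<chi> where v: "v \<in> V" "v \<notin> U" "\<And>a. a \<in> H \<Longrightarrow> bracket a v - \<chi> a *s v \<in> U"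
      by metis
    \<comment> \<open>The preimage in \<open>V\<close> of the \<open>\<chi>\<close>-weight space of
      \<open>H\<close> on \<open>V / U\<close>.\<close>
    define W where "W = {w\<in>V. \<forall>a\<in>H. bracket a w - \<chi> a *s w \<in> U}"
    have W: "subspace W"
    proof (rule subspaceI)
      show "0 \<in> W"
        using V(1) U(1) by (simp add: W_def subspace_0)
    next
      fix x y assume "x \<in> W" "y \<in> W"
      moreover have "bracket a (x + y) - \<chi> a *s (x + y) = (bracket a x - \<chi> a *s x) + (bracket a y - \<chi> a *s y)" for a
        by (simp add: bracket_linear algebra_simps)
      ultimately show "x + y \<in> W"
        using V(1) U(1) by (simp add: W_def subspace_add)
    next
      fix c x assume "x \<in> W"
      moreover have "bracket a (c *s x) - \<chi> a *s (c *s x) = c *s (bracket a x - \<chi> a *s x)" for a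
        by (simp add: bracket_linear algebra_simps)
      ultimately show "c *s x \<in> W"
        using V(1) U(1) by (simp add: W_def subspace_scale)
    qed
    have Hz: "bracket a z \<in> H" if "a \<in> H" for a
      using that H z bracket_in_derived by blast
    \<comment> \<open>Commuting \<open>a\<close> past \<open>z\<close> produces a term of weight
      \<open>\<chi> (bracket a z)\<close>, which must vanish for \<open>W\<close> to be stable under
      \<open>z\<close>.\<close>
    have lam0: "\<chi> (bracket a z) = 0" if "a \<in> H" for a
      using weight_vanishes_on_commutators[of U z H v \<chi> a] char0 U(1) less.prems z H v Hz that by blast
    have zW: "bracket z w \<in> W" if "w \<in> W" for w
    proof -
      have "bracket a (bracket z w) - \<chi> a *s bracket z w \<in> U" if "a \<in> H" for a
      proof -
        have "bracket a (bracket z w) - \<chi> a *s bracket z w =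
            (bracket (bracket a z) w - \<chi> (bracket a z) *s w) + bracket z (bracket a w - \<chi> a *s w)"
          by (simp add: lam0[OF that] bracket_derivation[of a z w] bracket_linear algebra_simps)
        also have "\<dots> \<in> U"
          using \<open>w \<in> W\<close> that Hz less.prems(4)[OF z(1)] by (intro subspace_add U(1)) (simp_all add: W_def)
        finally show ?thesis .
      qed
      then show ?thesis
        using less.prems z that by (auto simp: W_def)
    qed
    have "v \<in> W"
      using v by (simp add: W_def)
    then obtain x \<mu> where x: "x \<in> W" "x \<notin> U" "bracket z x - \<mu> *s x \<in> U"
      using exists_eigenvector_modulo[OF ac linear_bracket[of z] W zW U(1)] v by blast
    have "\<exists>c. bracket k x - c *s x \<in> U" if "k \<in> K" for k
    proof -
      obtain c where c: "k - c *s z \<in> H"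
        using z(3) \<open>k \<in> K\<close> by blast
      have "bracket k x - (\<chi> (k - c *s z) + c * \<mu>) *s x =
          (bracket (k - c *s z) x - \<chi> (k - c *s z) *s x) + c *s (bracket z x - \<mu> *s x)"
        by (simp add: bracket_linear algebra_simps)
      also have "\<dots> \<in> U"
        using x c U(1) by (intro subspace_add subspace_scale) (auto simp: W_def)
      finally show ?thesis
        by blast
    qed
    then show ?thesis
      using x by (auto simp: W_def)
  qed
qed

end

section \<open>Subalgebras of codimension one\<close>

text \<open>\<open>codim\<close> says that \<open>M / K\<close> is a line, and \<open>weight\<close>
  that \<open>k\<close> acts on it by the scalar \<open>\<chi> k\<close>. \<open>\<chi>\<close> is a
  plain function whose values matter only on \<open>K\<close>; that it is a character of
  \<open>K\<close> is derived.\<close>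

locale weighted_subalgebra = lie_algebra +
  fixes M K :: "'b set" and \<chi> :: "'b \<Rightarrow> 'a"
  assumes M: "lie_subalgebra M" and K: "lie_subalgebra K" and K_M: "K \<subset> M"
    and codim: "x \<in> M \<Longrightarrow> x \<notin> K \<Longrightarrow> m \<in> M \<Longrightarrow> \<exists>t. m - t *s x \<in> K"
    and weight: "k \<in> K \<Longrightarrow> m \<in> M \<Longrightarrow> bracket k m - \<chi> k *s m \<in> K"
begin

lemma subspace_K: "subspace K" and subspace_M: "subspace M"
  using K M by (simp_all add: lie_subalgebra_subspace)

text \<open>A vector \<open>x\<close> outside \<open>K\<close> is nonzero in \<open>M / K\<close>,
  so its eigenvalue is determined. Linearity of \<open>\<chi>\<close> follows by exhibiting
  eigenvalues.\<close>

lemma weight_unique: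
  assumes "x \<in> M" "x \<notin> K" "k \<in> K" "bracket k x - c *s x \<in> K"
  shows "\<chi> k = c"
proof (rule ccontr)
  assume "\<chi> k \<noteq> c"
  have "(\<chi> k - c) *s x = (bracket k x - c *s x) - (bracket k x - \<chi> k *s x)"
    by (simp add: algebra_simps)
  also have "\<dots> \<in> K"
    by (rule subspace_diff[OF subspace_K assms(4) weight[OF assms(3,1)]])
  finally have "inverse (\<chi> k - c) *s (\<chi> k - c) *s x \<in> K"
    using subspace_K subspace_scale by blast
  then show False
    using \<open>\<chi> k \<noteq> c\<close> assms(2) by simp
qed

lemma weight_add: "k \<in> K \<Longrightarrow> l \<in> K \<Longrightarrow> \<chi> (k + l) = \<chi> k + \<chi> l"
proof -
  assume kl: "k \<in> K" "l \<in> K"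
  obtain x where x: "x \<in> M" "x \<notin> K"
    using K_M by blast
  have "bracket (k + l) x - (\<chi> k + \<chi> l) *s x = (bracket k x - \<chi> k *s x) + (bracket l x - \<chi> l *s x)"
    by (simp add: bracket_linear algebra_simps)
  also have "\<dots> \<in> K"
    using kl x weight by (intro subspace_add subspace_K)
  finally show ?thesis
    using weight_unique[OF x] kl subspace_add[OF subspace_K] by blast
qed

lemma weight_scale: "k \<in> K \<Longrightarrow> \<chi> (a *s k) = a * \<chi> k"
proof -
  assume k: "k \<in> K"
  obtain x where x: "x \<in> M" "x \<notin> K"
    using K_M by blast
  have "bracket (a *s k) x - (a * \<chi> k) *s x = a *s (bracket k x - \<chi> k *s x)"
    by (simp add: bracket_linear algebra_simps)
  also have "\<dots> \<in> K"
    using k x weight by (intro subspace_scale subspace_K)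
  finally show ?thesis
    using weight_unique[OF x] k subspace_scale[OF subspace_K] by blast
qed

lemma weight_0: "\<chi> 0 = 0"
  using weight_scale[of 0 0] subspace_0[OF subspace_K] by simp

lemma weight_minus: "k \<in> K \<Longrightarrow> \<chi> (- k) = - \<chi> k"
  using weight_scale[of k "-1"] by simp

lemma weight_diff: "k \<in> K \<Longrightarrow> l \<in> K \<Longrightarrow> \<chi> (k - l) = \<chi> k - \<chi> l"
  using weight_add[of k "- l"] weight_minus[of l] subspace_neg[OF subspace_K] by simp

text \<open>Scalars on the line \<open>M / K\<close> commute, so commutators act on it by
  zero.\<close>

lemma weight_bracket:
  assumes "k \<in> K" "l \<in> K"
  shows "\<chi> (bracket k l) = 0"
proof -
  obtain x where x: "x \<in> M" "x \<notin> K"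
    using K_M by blast
  define r s where "r = bracket k x - \<chi> k *s x" and "s = bracket l x - \<chi> l *s x"
  have rs: "r \<in> K" "s \<in> K"
    using assms x weight by (simp_all add: r_def s_def)
  have "bracket (bracket k l) x - 0 *s x = bracket k (bracket l x) - bracket l (bracket k x)"
    by (simp add: bracket_derivation[of k l x])
  also have "\<dots> = (bracket k s + \<chi> l *s r) - (bracket l r + \<chi> k *s s)"
    by (simp add: r_def s_def bracket_linear algebra_simps)
  also have "\<dots> \<in> K"
    using assms rs by (intro subspace_add subspace_diff subspace_scale subspace_K lie_subalgebra_bracket K)
  finally show ?thesis
    using weight_unique[OF x] assms lie_subalgebra_bracket[OF K] by blast
qed

definition ker :: "'b set" where
  "ker = {k \<in> K. \<chi> k = 0}"

lemma subspace_ker: "subspace ker"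
  using subspace_K
  by (auto intro!: subspaceI simp: ker_def weight_0 weight_add weight_scale subspace_0 subspace_add subspace_scale)

lemma ker_bracket: "y \<in> ker \<Longrightarrow> m \<in> M \<Longrightarrow> bracket m y \<in> K"
  using weight[of y m] subspace_neg[OF subspace_K, of "bracket y m"] bracket_anticommute[of m y]
  by (simp add: ker_def)

lemma bracket_in_ker: "k \<in> K \<Longrightarrow> l \<in> K \<Longrightarrow> bracket k l \<in> ker"
  using weight_bracket lie_subalgebra_bracket[OF K] by (simp add: ker_def)

text \<open>The pairing is invariant because \<open>\<chi>\<close> kills
  \<open>bracket h (bracket x y)\<close>. As \<open>h\<close> acts by \<open>\<chi> h\<close> on
  \<open>x\<close> modulo \<open>K\<close>, it contributes \<open>- \<chi> h\<close> on the side of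
  \<open>y\<close>.\<close>

lemma pairing_bracket:
  assumes "x \<in> M" "y \<in> ker" "h \<in> K"
  shows "\<chi> (bracket x (bracket h y)) = - \<chi> h * \<chi> (bracket x y)"
proof -
  let ?r = "bracket h x - \<chi> h *s x"
  have xy: "bracket x y \<in> K" and yK: "y \<in> K"
    using assms ker_bracket by (auto simp: ker_def)
  have r: "?r \<in> K"
    using assms weight by blast
  have "bracket x (bracket h y) = bracket h (bracket x y) - (bracket ?r y + \<chi> h *s bracket x y)"
    using bracket_derivation[of h x y] by (simp add: bracket_linear)
  then have "\<chi> (bracket x (bracket h y)) = \<chi> (bracket h (bracket x y)) - (\<chi> (bracket ?r y) + \<chi> h * \<chi> (bracket x y))"
    using assms xy yK r lie_subalgebra_bracket[OF K] subspace_scale[OF subspace_K] subspace_add[OF subspace_K]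
    by (simp add: weight_diff weight_add weight_scale)
  then show ?thesis
    using weight_bracket[OF assms(3) xy] weight_bracket[OF r yK] by simp
qed

text \<open>
  A triple \<open>x, y, [x, y]\<close> with \<open>\<chi> [x, y] \<noteq> 0\<close> behaves like a copy of \<open>sl\<^sub>2\<close> modulo the kernel of \<open>\<chi>\<close>:
  bracketing \<open>x\<close> and \<open>y\<close> with \<open>[x, y]\<close> reproduces such a triple one step further down the
  derived series.
\<close>

lemma not_solvable_if_pairing:
  assumes N: "lie_subalgebra N" "N \<subseteq> M"
    and x: "x \<in> N" "x \<notin> K" and y: "y \<in> N" "y \<in> ker" and xy: "\<chi> (bracket x y) \<noteq> 0"
  shows "\<not> solvable N"
proof -
  have "\<exists>x y. x \<in> derived_series N n \<and> x \<notin> K \<and> y \<in> derived_series N n \<and> y \<in> ker \<and> \<chi> (bracket x y) \<noteq> 0" for n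
  proof (induction n)
    case 0
    then show ?case
      using x y xy by auto
  next
    case (Suc n)
    then obtain x y where x: "x \<in> derived_series N n" "x \<notin> K"
      and y: "y \<in> derived_series N n" "y \<in> ker" and xy: "\<chi> (bracket x y) \<noteq> 0"
      by blast
    have "derived_series N k \<subseteq> N" for k
      by (induction k) (use derived_subset lie_subalgebra_derived_series[OF N(1)] in force)+
    then have xM: "x \<in> M"
      using x N by blast
    define z where "z = bracket x y"
    have z: "z \<in> K" "z \<in> derived_series N n"
      using ker_bracket[OF y(2) xM] lie_subalgebra_bracket[OF lie_subalgebra_derived_series[OF N(1)] x(1) y(1)]
      by (simp_all add: z_def)
    have c: "\<chi> z \<noteq> 0"
      using xy by (simp add: z_def)
    have zx: "bracket z x - \<chi> z *s x \<in> K"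
      using weight z xM by blast
    have "bracket z x \<notin> K"
    proof
      assume "bracket z x \<in> K"
      then have "bracket z x - 0 *s x \<in> K"
        by simp
      then show False
        using weight_unique[OF xM x(2) z(1)] c by blast
    qed
    moreover have zy: "bracket z y \<in> ker"
      using bracket_in_ker z y by (simp add: ker_def)
    \<comment> \<open>One factor comes from \<open>bracket z x\<close> being
      \<open>\<chi> z *s x\<close> modulo \<open>K\<close>, one with the sign from
      \<open>pairing_bracket\<close>, and the last is the old pairing.\<close>
    moreover have "\<chi> (bracket (bracket z x) (bracket z y)) = - \<chi> z * \<chi> z * \<chi> z"
    proof -
      let ?r = "bracket z x - \<chi> z *s x"
      have "bracket (bracket z x) (bracket z y) = bracket ?r (bracket z y) + \<chi> z *s bracket x (bracket z y)"
        by (simp add: bracket_linear)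
      also have "\<chi> \<dots> = \<chi> (bracket ?r (bracket z y)) + \<chi> z * \<chi> (bracket x (bracket z y))"
        using zx zy ker_bracket[OF zy xM] lie_subalgebra_bracket[OF K zx] subspace_scale[OF subspace_K]
        by (simp add: weight_add weight_scale ker_def)
      also have "\<chi> (bracket ?r (bracket z y)) = 0"
        using weight_bracket zx zy by (simp add: ker_def)
      also have "\<chi> (bracket x (bracket z y)) = - \<chi> z * \<chi> z"
        using pairing_bracket[OF xM y(2) z(1)] by (simp add: z_def)
      finally show ?thesis
        by simp
    qed
    moreover have "bracket z x \<in> derived_series N (Suc n)" "bracket z y \<in> derived_series N (Suc n)"
      using bracket_in_derived z x y by simp_all
    ultimately show ?case
      using c by (intro exI[of _ "bracket z x"] exI[of _ "bracket z y"]) simp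
  qed
  moreover have "0 \<in> K"
    using subspace_0[OF subspace_K] .
  ultimately show ?thesis
    unfolding solvable_def by (metis singletonD)
qed

text \<open>If \<open>x\<close> paired to zero with all of \<open>ker\<close>, then
  \<open>derived M\<close> would lie in a proper subspace: in \<open>K\<close> when
  \<open>\<chi>\<close> vanishes on \<open>K\<close>, and otherwise in the sum of \<open>ker\<close>
  and the line through \<open>bracket h x\<close>, which misses \<open>h\<close>.\<close>

lemma exists_pairing_if_perfect:
  assumes perfect: "derived M = M" and x: "x \<in> M" "x \<notin> K"
  shows "\<exists>y\<in>ker. \<chi> (bracket x y) \<noteq> 0"
proof (rule ccontr)
  assume "\<not> ?thesis"
  then have pair: "bracket x y \<in> ker" if "y \<in> ker" for y
    using that ker_bracket x by (auto simp: ker_def)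
  show False
  proof (cases "\<exists>h\<in>K. \<chi> h \<noteq> 0")
    case False
    then have "bracket k m \<in> K" if "k \<in> K" "m \<in> M" for k m
      using that weight[of k m] by simp
    then have ideal: "bracket m k \<in> K" "bracket k m \<in> K" if "k \<in> K" "m \<in> M" for k m
      using that subspace_neg[OF subspace_K] bracket_anticommute[of m k] by auto
    have "bracket m m' \<in> K" if mm: "m \<in> M" "m' \<in> M" for m m'
    proof -
      obtain t where t: "m - t *s x \<in> K"
        using codim x mm by blast
      obtain t' where t': "m' - t' *s x \<in> K"
        using codim x mm by blast
      have "bracket m m' = bracket (m - t *s x) m' + t *s bracket x (m' - t' *s x)"
        by (simp add: bracket_linear bracket_self)
      then show ?thesis
        using t t' mm x ideal by (simp add: subspace_add[OF subspace_K] subspace_scale[OF subspace_K])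
    qed
    then have "derived M \<subseteq> K"
      by (intro span_minimal subspace_K) auto
    then show False
      using perfect K_M by auto
  next
    case True
    then obtain h where h: "h \<in> K" "\<chi> h \<noteq> 0"
      by blast
    define v where "v = bracket h x"
    \<comment> \<open>The sum of \<open>ker\<close> and the line of \<open>v\<close>. It absorbs all
      brackets because \<open>K\<close> is spanned by \<open>ker\<close> and \<open>h\<close>, and
      \<open>M\<close> by \<open>K\<close> and \<open>x\<close>.\<close>
    define N where "N = {n. \<exists>s. n - s *s v \<in> ker}"
    have N: "subspace N"
    proof (rule subspaceI)
      show "0 \<in> N"
        using subspace_0[OF subspace_ker] by (auto simp: N_def intro!: exI[of _ 0])
    next
      fix a b assume "a \<in> N" "b \<in> N"
      then obtain s t where "a - s *s v \<in> ker" "b - t *s v \<in> ker"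
        by (auto simp: N_def)
      then show "a + b \<in> N"
        using subspace_add[OF subspace_ker, of "a - s *s v" "b - t *s v"]
        by (auto simp: N_def algebra_simps intro!: exI[of _ "s + t"])
    next
      fix c a assume "a \<in> N"
      then obtain s where "a - s *s v \<in> ker"
        by (auto simp: N_def)
      then show "c *s a \<in> N"
        using subspace_scale[OF subspace_ker, of "a - s *s v" c]
        by (auto simp: N_def algebra_simps intro!: exI[of _ "c * s"])
    qed
    have kx: "bracket k x \<in> N" if "k \<in> K" for k
    proof -
      define c where "c = \<chi> k / \<chi> h"
      have y: "k - c *s h \<in> ker"
        using that h subspace_diff[OF subspace_K] subspace_scale[OF subspace_K]
        by (simp add: ker_def weight_diff weight_scale c_def)
      have "bracket k x - c *s v = - bracket x (k - c *s h)"
        by (subst bracket_anticommute) (simp add: v_def bracket_linear)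
      then have "bracket k x - c *s v \<in> ker"
        using pair[OF y] subspace_neg[OF subspace_ker] by simp
      then show ?thesis
        by (auto simp: N_def)
    qed
    have ker_N: "ker \<subseteq> N"
      by (auto simp: N_def intro!: exI[of _ 0])
    have "bracket m m' \<in> N" if mm: "m \<in> M" "m' \<in> M" for m m'
    proof -
      obtain t where t: "m - t *s x \<in> K"
        using codim x mm by blast
      obtain t' where t': "m' - t' *s x \<in> K"
        using codim x mm by blast
      define k k' where "k = m - t *s x" and "k' = m' - t' *s x"
      have m: "m = k + t *s x" and m': "m' = k' + t' *s x"
        by (simp_all add: k_def k'_def)
      have "bracket m m' = bracket k k' + t' *s bracket k x - t *s bracket k' x"
        using bracket_anticommute[of x k'] by (simp add: m m' bracket_linear bracket_self)
      moreover have "bracket k k' \<in> N" "bracket k x \<in> N" "bracket k' x \<in> N"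
        using t t' bracket_in_ker ker_N kx by (auto simp: k_def k'_def)
      ultimately show ?thesis
        by (simp add: subspace_add[OF N] subspace_diff[OF N] subspace_scale[OF N])
    qed
    then have "derived M \<subseteq> N"
      by (intro span_minimal N) auto
    then have "h \<in> N"
      using perfect h K_M by auto
    then obtain s where s: "h - s *s v \<in> ker"
      by (auto simp: N_def)
    show False
    proof (cases "s = 0")
      case True
      then show False
        using s h by (simp add: ker_def)
    next
      case False
      have "h - s *s v \<in> K"
        using s by (simp add: ker_def)
      from subspace_diff[OF subspace_K h(1) this] have "s *s v \<in> K"
        by simp
      then have "inverse s *s s *s v \<in> K"
        using subspace_scale[OF subspace_K] by blast
      then have "bracket h x - 0 *s x \<in> K"
        using False by (simp add: v_def)
      then show False
        using weight_unique[OF x h(1)] h(2) by blast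
    qed
  qed
qed

lemma exists_not_in_solvabilizer:
  assumes two: "(2 :: 'a) \<noteq> 0" and h: "h \<in> K" "\<chi> h = 1"
    and x: "x \<in> M" "x \<notin> K" and y: "y \<in> ker" "\<chi> (bracket x y) \<noteq> 0"
  shows "\<exists>w\<in>M. w \<notin> solvabilizer h"
proof -
  \<comment> \<open>Since \<open>\<chi> h = 1\<close>, adding \<open>a *s h\<close> to
    \<open>x\<close> makes \<open>bracket h x1 - x1\<close>, which is \<open>k\<close>, fall into
    \<open>ker\<close>.\<close>
  define a where "a = \<chi> (bracket h x - x)"
  define x1 where "x1 = x + a *s h"
  define k where "k = bracket h x - x - a *s h"
  have hM: "h \<in> M"
    using h K_M by blast
  have hx: "bracket h x - x \<in> K"
    using weight[OF h(1) x(1)] h(2) by simp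
  have k: "k \<in> ker"
    using hx h subspace_diff[OF subspace_K] subspace_scale[OF subspace_K]
    by (simp add: k_def ker_def weight_diff weight_scale a_def)
  have x1M: "x1 \<in> M"
    using x hM by (simp add: x1_def subspace_add[OF subspace_M] subspace_scale[OF subspace_M])
  \<comment> \<open>The pairing sees its first argument only modulo \<open>K\<close>, since
    \<open>\<chi>\<close> kills brackets within \<open>K\<close>.\<close>
  have pair_x1: "\<chi> (bracket (x1 + u) v) = \<chi> (bracket x v)" if "u \<in> K" "v \<in> ker" for u v
  proof -
    have "bracket (x1 + u) v = bracket x v + bracket (a *s h + u) v"
      by (simp add: x1_def bracket_linear)
    moreover have "a *s h + u \<in> K" "v \<in> K"
      using that h by (simp_all add: subspace_add[OF subspace_K] subspace_scale[OF subspace_K] ker_def)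
    ultimately show ?thesis
      using that ker_bracket[OF that(2) x(1)] lie_subalgebra_bracket[OF K]
      by (simp add: weight_add weight_bracket)
  qed
  have hx1: "bracket h x1 = x1 + k"
    by (simp add: x1_def k_def bracket_linear bracket_self)
  \<comment> \<open>\<open>y \<mapsto> \<chi> [x, y]\<close> has eigenvalue \<open>-1\<close> under \<open>ad h\<close>, so moving \<open>w\<close> by \<open>u\<close> moves the value by \<open>-2 \<chi> [x, u]\<close>.\<close>
  have shifted: "\<chi> (bracket (x1 + u) (bracket h (x1 + u) - (x1 + u))) = \<chi> (bracket x k) - 2 * \<chi> (bracket x u)"
    "bracket h (x1 + u) - (x1 + u) \<in> ker" if u: "u \<in> ker" for u
  proof -
    have e: "bracket h (x1 + u) - (x1 + u) = k + (bracket h u - u)"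
      by (simp add: bracket_linear hx1)
    have hu: "bracket h u \<in> ker"
      using u h bracket_in_ker by (simp add: ker_def)
    then show *: "bracket h (x1 + u) - (x1 + u) \<in> ker"
      unfolding e using k u by (intro subspace_add[OF subspace_ker] subspace_diff[OF subspace_ker])
    have "\<chi> (bracket (x1 + u) (bracket h (x1 + u) - (x1 + u))) = \<chi> (bracket x (k + (bracket h u - u)))"
      using pair_x1[OF _ *] u unfolding e by (simp add: ker_def)
    also have "\<dots> = \<chi> (bracket x k + (bracket x (bracket h u) - bracket x u))"
      by (simp add: bracket_linear)
    also have "\<dots> = \<chi> (bracket x k) + (\<chi> (bracket x (bracket h u)) - \<chi> (bracket x u))"
      using ker_bracket[OF _ x(1)] k hu u subspace_diff[OF subspace_K] by (simp add: weight_add weight_diff)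
    also have "\<chi> (bracket x (bracket h u)) = - \<chi> (bracket x u)"
      using pairing_bracket[OF x(1) u h(1)] h(2) by simp
    finally show "\<chi> (bracket (x1 + u) (bracket h (x1 + u) - (x1 + u))) = \<chi> (bracket x k) - 2 * \<chi> (bracket x u)"
      by simp
  qed
  \<comment> \<open>If \<open>k\<close> already pairs nontrivially with \<open>x\<close>, take
    \<open>u = 0\<close>; otherwise \<open>u = y\<close> works because \<open>2\<close> is
    nonzero.\<close>
  obtain u where u: "u \<in> ker" "\<chi> (bracket x k) - 2 * \<chi> (bracket x u) \<noteq> 0"
  proof (cases "\<chi> (bracket x k) = 0")
    case True
    then show thesis
      using that[OF y(1)] y(2) two by simp
  next
    case False
    then show thesis
      using that[OF subspace_0[OF subspace_ker]] by (simp add: weight_0)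
  qed
  define w where "w = x1 + u"
  have uK: "u \<in> K"
    using u by (simp add: ker_def)
  have w: "w \<in> M"
    using x1M uK K_M by (auto simp: w_def intro!: subspace_add[OF subspace_M])
  have "w \<notin> K"
  proof
    assume "w \<in> K"
    moreover have "x = w - (a *s h + u)"
      by (simp add: w_def x1_def)
    moreover have "a *s h + u \<in> K"
      using h uK by (simp add: subspace_add[OF subspace_K] subspace_scale[OF subspace_K])
    ultimately show False
      using x(2) subspace_diff[OF subspace_K] by metis
  qed
  moreover have "bracket h w - w \<in> generated h w"
    using lie_subalgebra_generated[of h w] generated_left generated_right
    by (intro subspace_diff lie_subalgebra_subspace lie_subalgebra_bracket) auto
  ultimately have "\<not> solvable (generated h w)"
    using not_solvable_if_pairing[OF lie_subalgebra_generated generated_subset[OF M hM w] generated_right]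
      shifted[OF u(1)] u(2) by (simp add: w_def)
  then show ?thesis
    using w by (auto simp: solvabilizer_def)
qed

end

section \<open>Minimal nonsolvable subalgebras and their maximal subalgebras\<close>

context based_lie_algebra
begin

text \<open>Take \<open>K\<close> maximal among proper subalgebras through \<open>x\<close>. A
  common eigenvector \<open>v\<close> of \<open>K\<close> modulo \<open>K\<close> makes
  \<open>K\<close> plus the line of \<open>v\<close> a subalgebra, which by maximality is
  \<open>M\<close>.\<close>

lemma exists_codim_one_subalgebra:
  assumes ac: "algebraically_closed TYPE('f)" and char0: "CHAR('f) = 0"
    and M: "lie_subalgebra M" "\<not> solvable M"
    and proper: "\<And>N. lie_subalgebra N \<Longrightarrow> N \<subset> M \<Longrightarrow> solvable N"
    and x: "x \<in> M"
  obtains K \<chi> where "weighted_subalgebra scale bracket M K \<chi>" "x \<in> K"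
proof -
  let ?P = "\<lambda>K. lie_subalgebra K \<and> x \<in> K \<and> K \<subset> M"
  \<comment> \<open>The line of \<open>x\<close> starts the maximality argument; it is proper
    because it is solvable and \<open>M\<close> is not.\<close>
  have "span {x} \<subseteq> M"
    using x lie_subalgebra_subspace[OF M(1)] by (intro span_minimal) auto
  moreover have "span {x} \<noteq> M"
    using solvable_span_singleton M(2) by metis
  ultimately have "?P (span {x})"
    using lie_subalgebra_span_singleton span_base[of x "{x}"] by simp
  then have "\<exists>K. ?P K \<and> (\<forall>N. ?P N \<longrightarrow> dim N \<le> dim K)"
    by (rule ex_has_greatest_nat[of ?P _ dim "Suc dimension"]) (simp add: dim_subset_UNIV less_Suc_eq_le)
  then obtain K where K: "lie_subalgebra K" "x \<in> K" "K \<subset> M"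
    and max: "\<And>N. ?P N \<Longrightarrow> dim N \<le> dim K"
    by blast
  have sK: "subspace K" and sM: "subspace M"
    using K M by (simp_all add: lie_subalgebra_subspace)
  have "\<exists>v\<in>M. v \<notin> K \<and> (\<forall>k\<in>K. \<exists>c. bracket k v - c *s v \<in> K)"
    using K lie_subalgebra_bracket[OF M(1)] lie_subalgebra_bracket[OF K(1)]
    by (intro lie_theorem_modulo[OF ac char0 K(1) proper[OF K(1,3)]] sK sM) auto
  then obtain v \<chi> where v: "v \<in> M" "v \<notin> K" "\<And>k. k \<in> K \<Longrightarrow> bracket k v - \<chi> k *s v \<in> K"
    by metis
  define N where "N = {n. \<exists>t. n - t *s v \<in> K}"
  have N_iff: "n \<in> N \<longleftrightarrow> (\<exists>k t. k \<in> K \<and> n = k + t *s v)" for n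
  proof
    assume "n \<in> N"
    then obtain t where "n - t *s v \<in> K"
      by (auto simp: N_def)
    moreover have "n = (n - t *s v) + t *s v"
      by simp
    ultimately show "\<exists>k t. k \<in> K \<and> n = k + t *s v"
      by blast
  next
    assume "\<exists>k t. k \<in> K \<and> n = k + t *s v"
    then show "n \<in> N"
      unfolding N_def by (metis (mono_tags, lifting) add_diff_cancel_right' mem_Collect_eq)
  qed
  have "span (insert v K) = N"
    using span_breakdown_eq[of _ v K] span_eq_iff[THEN iffD2, OF sK] by (auto simp: N_def)
  then have sN: "subspace N"
    by (metis subspace_span)
  have KN: "K \<subseteq> N"
    by (auto simp: N_def intro!: exI[of _ 0])
  have vN: "v \<in> N"
    using subspace_0[OF sK] by (auto simp: N_def intro!: exI[of _ 1])
  have kv: "bracket k v \<in> N" if "k \<in> K" for k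
    using v(3)[OF that] by (auto simp: N_def)
  have "bracket n n' \<in> N" if nn: "n \<in> N" "n' \<in> N" for n n'
  proof -
    obtain k t k' t' where n: "k \<in> K" "n = k + t *s v" "k' \<in> K" "n' = k' + t' *s v"
      using nn N_iff by metis
    have "bracket n n' = bracket k k' + t' *s bracket k v - t *s bracket k' v"
      using bracket_anticommute[of v k'] by (simp add: n bracket_linear bracket_self)
    moreover have "bracket k k' \<in> N"
      using KN n lie_subalgebra_bracket[OF K(1)] by blast
    ultimately show ?thesis
      using kv n by (simp add: subspace_add[OF sN] subspace_diff[OF sN] subspace_scale[OF sN])
  qed
  then have "lie_subalgebra N"
    using sN by (simp add: lie_subalgebra_def)
  moreover have "dim K < dim N"
    using KN vN v(2) by (intro dim_psubset_subspaces sK sN) blast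
  moreover have "N \<subseteq> M"
    using N_iff K(3) v(1) by (auto intro!: subspace_add[OF sM] subspace_scale[OF sM])
  ultimately have MN: "N = M"
    using max[of N] KN K(2) by auto
  have codim: "\<exists>t. m - t *s w \<in> K" if w: "w \<in> M" "w \<notin> K" "m \<in> M" for w m
  proof -
    obtain k t k' t' where n: "k \<in> K" "w = k + t *s v" "k' \<in> K" "m = k' + t' *s v"
      using w N_iff MN by metis
    then have "t \<noteq> 0"
      using w(2) by auto
    then have "m - (t' / t) *s w = k' - (t' / t) *s k"
      by (simp add: n algebra_simps)
    then show ?thesis
      using n subspace_diff[OF sK] subspace_scale[OF sK] by metis
  qed
  have weight: "bracket k m - \<chi> k *s m \<in> K" if km: "k \<in> K" "m \<in> M" for k m
  proof -
    obtain l t where l: "l \<in> K" "m = l + t *s v"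
      using km N_iff MN by metis
    have "bracket k m - \<chi> k *s m = (bracket k l - \<chi> k *s l) + t *s (bracket k v - \<chi> k *s v)"
      by (simp add: l bracket_linear algebra_simps)
    also have "\<dots> \<in> K"
      using km l v(3) lie_subalgebra_bracket[OF K(1)]
      by (simp add: subspace_add[OF sK] subspace_diff[OF sK] subspace_scale[OF sK])
    finally show ?thesis .
  qed
  have "weighted_subalgebra scale bracket M K \<chi>"
    by unfold_locales (use M(1) K codim weight in auto)
  then show thesis
    using that K(2) by blast
qed

lemma solvable_if_solvabilizers_subalgebras:
  assumes ac: "algebraically_closed TYPE('f)" and char0: "CHAR('f) = 0"
    and sol: "\<And>x. lie_subalgebra (solvabilizer x)"
  shows "solvable UNIV"
proof (rule ccontr)
  assume "\<not> solvable UNIV"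
  then have "\<exists>M. (lie_subalgebra M \<and> \<not> solvable M) \<and> (\<forall>N. lie_subalgebra N \<and> \<not> solvable N \<longrightarrow> dim M \<le> dim N)"
    by (intro ex_has_least_nat[of _ UNIV]) simp
  then obtain M where M: "lie_subalgebra M" "\<not> solvable M"
    and min: "\<And>N. lie_subalgebra N \<Longrightarrow> \<not> solvable N \<Longrightarrow> dim M \<le> dim N"
    by blast
  have proper: "solvable N" if "lie_subalgebra N" "N \<subset> M" for N
    using min[OF that(1)] dim_psubset_subspaces[of N M] that M(1) lie_subalgebra_subspace by force
  have perfect: "derived M = M"
  proof (rule ccontr)
    assume "derived M \<noteq> M"
    then have "solvable (derived M)"
      using proper[OF lie_subalgebra_derived[OF M(1)]] derived_subset[OF M(1)] by (simp only: psubset_eq simp_thms)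
    then have "solvable M"
      by (rule solvable_if_derived)
    then show False
      using M(2) by contradiction
  qed
  have "0 \<in> M"
    using subspace_0[OF lie_subalgebra_subspace[OF M(1)]] .
  \<comment> \<open>Any element of \<open>M\<close> may be prescribed for the first subalgebra;
    \<open>0\<close> imposes no condition.\<close>
  obtain K \<chi> where "weighted_subalgebra scale bracket M K \<chi>"
    using exists_codim_one_subalgebra[OF ac char0 M proper \<open>0 \<in> M\<close>] by metis
  then interpret K: weighted_subalgebra scale bracket M K \<chi> .
  obtain x where x: "x \<in> M" "x \<notin> K"
    using K.K_M by blast
  obtain y where y: "y \<in> K.ker" "\<chi> (bracket x y) \<noteq> 0"
    using K.exists_pairing_if_perfect[OF perfect x] by blast
  obtain K' \<chi>' where "weighted_subalgebra scale bracket M K' \<chi>'" and x': "x \<in> K'"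
    using exists_codim_one_subalgebra[OF ac char0 M proper x(1)] by metis
  then interpret K': weighted_subalgebra scale bracket M K' \<chi>' by simp
  define z where "z = bracket x y"
  have yK: "y \<in> K" and zK: "z \<in> K" and z: "\<chi> z \<noteq> 0"
    using y K.ker_bracket[OF y(1) x(1)] by (auto simp: z_def K.ker_def)
  \<comment> \<open>If \<open>y\<close> lies in \<open>K'\<close>, so does \<open>z\<close>, because
    \<open>x\<close> does. If not, a multiple of \<open>y\<close> moves \<open>z\<close> into
    \<open>K'\<close> without changing \<open>\<chi> z\<close>, as \<open>y\<close> is in
    \<open>ker\<close>.\<close>
  obtain g where g: "g \<in> K" "g \<in> K'" "\<chi> g \<noteq> 0"
  proof (cases "y \<in> K'")
    case True
    then show thesis
      using that[OF zK _ z] x' lie_subalgebra_bracket[OF K'.K] by (simp add: z_def)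
  next
    case False
    then obtain t where "z - t *s y \<in> K'"
      using K'.codim[of y z] yK zK K.K_M by blast
    moreover have "\<chi> (z - t *s y) = \<chi> z"
      using yK zK y(1) K.subspace_K by (simp add: K.weight_diff K.weight_scale subspace_scale K.ker_def)
    ultimately show thesis
      using that[of "z - t *s y"] yK zK z K.subspace_K by (simp add: subspace_diff subspace_scale)
  qed
  define h where "h = inverse (\<chi> g) *s g"
  have h: "h \<in> K" "h \<in> K'" "\<chi> h = 1"
    using g K.subspace_K K'.subspace_K by (simp_all add: h_def subspace_scale K.weight_scale)
  have "K \<subseteq> solvabilizer h" "x \<in> solvabilizer h"
    using in_solvabilizer[OF proper[OF K.K K.K_M] K.K h(1)]
      in_solvabilizer[OF proper[OF K'.K K'.K_M] K'.K h(2) x'] by auto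
  moreover have "m \<in> solvabilizer h" if m: "m \<in> M" for m
  proof -
    obtain t where "m - t *s x \<in> K"
      using K.codim x m by blast
    then have "(m - t *s x) + t *s x \<in> solvabilizer h"
      using calculation lie_subalgebra_subspace[OF sol[of h]]
      by (intro subspace_add subspace_scale) auto
    then show ?thesis
      by simp
  qed
  moreover have "(2 :: 'f) \<noteq> 0"
    using of_nat_eq_0_iff_char_dvd[of 2, where 'a = 'f] char0 by simp
  ultimately show False
    using K.exists_not_in_solvabilizer[OF _ h(1,3) x y] by blast
qed

end

theorem proposition3p24:
  fixes scale :: "'f::field \<Rightarrow> 'v::ab_group_add \<Rightarrow> 'v"
    and bracket :: "'v \<Rightarrow> 'v \<Rightarrow> 'v"
  assumes L: "finite_dim_lie_algebra scale bracket"
  shows "(lie_algebra.solvable scale bracket UNIV \<longrightarrow>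
            finite_dim_lie_algebra.S_lie_algebra scale bracket \<and>
            (\<forall>x. lie_algebra.solvabilizer scale bracket x = UNIV)) \<and>
         (algebraically_closed TYPE('f) \<and> CHAR('f) = 0 \<longrightarrow>
            finite_dim_lie_algebra.S_lie_algebra scale bracket \<longrightarrow>
            lie_algebra.solvable scale bracket UNIV) \<and>
         (algebraically_closed TYPE('f) \<and> CHAR('f) = 0 \<longrightarrow>
            (lie_algebra.solvable scale bracket UNIV \<longleftrightarrow>
             finite_dim_lie_algebra.S_lie_algebra scale bracket))"
proof -
  interpret finite_dim_lie_algebra scale bracket
    by (rule L)
  obtain B where B: "finite B" "span B = UNIV"
    using finite_dim by blast
  \<comment> \<open>The locale with dimension theory takes a basis as parameter, so the spanning set
    is thinned to an independent one.\<close>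
  obtain C where C: "C \<subseteq> B" "independent C" "B \<subseteq> span C"
    using maximal_independent_subset[of B] by metis
  have "span C = UNIV"
    using B C span_minimal[OF C(3) subspace_span] by auto
  then interpret based_lie_algebra scale bracket C
    using B C finite_subset by unfold_locales auto
  have "S_lie_algebra \<and> (\<forall>x. solvabilizer x = UNIV)" if "solvable UNIV"
    using that by (simp add: S_lie_algebra_def solvabilizer_eq_UNIV)
  moreover have "solvable UNIV" if "algebraically_closed TYPE('f)" "CHAR('f) = 0" S_lie_algebra
    using that solvable_if_solvabilizers_subalgebras by (simp add: S_lie_algebra_def)
  ultimately show ?thesis
    by blast
qed

end
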